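(* For every $n\ge 2$ there is an exact sequence of groups $$1\longrightarrow H_n\longrightarrow G_n\longrightarrow S_n\longrightarrow 1,$$ where $H_n=\pi_n(\mathcal{P}_n)\to G_n=\pi_n(\mathcal{B}_n)$ is the inclusion and $S_n$ is the symmetric group on $n$ letters. In other words, $G_n$ is an extension of $H_n$ by $S_n$ (the subgroup $H_n$ is normal in $G_n$ and is the kernel of a surjective homomorphism $G_n\to S_n$).
   Context: $\mathcal{B}_n$ is Artin's braid group with generators $\sigma_1,\dots,\sigma_{n-1}$ and relations $\sigma_i\sigma_j=\sigma_j\sigma_i$ for $|i-j|\ge 2$ and $\sigma_i\sigma_{i+1}\sigma_i=\sigma_{i+1}\sigma_i\sigma_{i+1}$ for $1\le i\le n-2$. The pure braid group $\mathcal{P}_n$ is the kernel of the homomorphism $\mathcal{B}_n\to S_n$, $\sigma_i\mapsto (i,i+1)$. It is generated by all conjugates in $\mathcal{B}_n$ of the elements $\sigma_i^2$. Let $I_m$ be the $m\times m$ identity matrix and $$R=\frac{1}{\sqrt2}\begin{pmatrix}1&0&0&1\\0&1&-1&0\\0&1&1&0\\-1&0&0&1\end{pmatrix},$$ which satisfies the Yang-Baxter equation $(R\otimes I_2)(I_2\otimes R)(R\otimes I_2)=(I_2\otimes R)(R\otimes I_2)(I_2\otimes R)$. The representation $\pi_n$ of $\mathcal{B}_n$ on $(\mathbb{C}^2)^{\otimes n}$ is defined by $\pi_n(\sigma_i)=I_2^{\otimes (i-1)}\otimes R\otimes I_2^{\otimes (n-i-1)}$. Tensor products of matrices use the "left into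 right" convention: if $A=\begin{pmatrix}a&b\\c&d\end{pmatrix}$ then $X\otimes A=\begin{pmatrix}aX&bX\\ cX&dX\end{pmatrix}$. *)

theory Defs
  imports "HOL-Algebra.Algebra" "Jordan_Normal_Form.Matrix"
begin

section \<open>Groups given by generators and relations\<close>

text \<open>A letter \<open>(x, True)\<close> stands for the generator \<open>x\<close>, and \<open>(x, False)\<close> for its formal inverse.\<close>

type_synonym 'g word = "('g \<times> bool) list"

definition words :: "'g set \<Rightarrow> 'g word set" where
  "words S = {w. fst ` set w \<subseteq> S}"

inductive pres_eq :: "'g set \<Rightarrow> ('g word \<times> 'g word) set \<Rightarrow> 'g word \<Rightarrow> 'g word \<Rightarrow> bool"
  for S :: "'g set" and rels :: "('g word \<times> 'g word) set" where
  refl: "w \<in> words S \<Longrightarrow> pres_eq S rels w w"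
| sym: "pres_eq S rels u v \<Longrightarrow> pres_eq S rels v u"
| trans: "pres_eq S rels u v \<Longrightarrow> pres_eq S rels v w \<Longrightarrow> pres_eq S rels u w"
| cancel: "u \<in> words S \<Longrightarrow> v \<in> words S \<Longrightarrow> x \<in> S \<Longrightarrow>
    pres_eq S rels (u @ [(x, b), (x, \<not> b)] @ v) (u @ v)"
| rel: "u \<in> words S \<Longrightarrow> v \<in> words S \<Longrightarrow> (r, s) \<in> rels \<Longrightarrow> r \<in> words S \<Longrightarrow> s \<in> words S \<Longrightarrow>
    pres_eq S rels (u @ r @ v) (u @ s @ v)"

definition pres_rel :: "'g set \<Rightarrow> ('g word \<times> 'g word) set \<Rightarrow> ('g word \<times> 'g word) set" where
  "pres_rel S rels = {(u, v). pres_eq S rels u v}"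

definition presented_group :: "'g set \<Rightarrow> ('g word \<times> 'g word) set \<Rightarrow> 'g word set monoid" where
  "presented_group S rels =
    \<lparr>carrier = words S // pres_rel S rels,
     monoid.mult = (\<lambda>A B. \<Union>u\<in>A. \<Union>v\<in>B. pres_rel S rels `` {u @ v}),
     one = pres_rel S rels `` {[]}\<rparr>"

fun word_eval :: "('a, 'm) monoid_scheme \<Rightarrow> ('g \<Rightarrow> 'a) \<Rightarrow> 'g word \<Rightarrow> 'a" where
  "word_eval G f [] = \<one>\<^bsub>G\<^esub>"
| "word_eval G f ((x, b) # w) = (if b then f x else inv\<^bsub>G\<^esub> (f x)) \<otimes>\<^bsub>G\<^esub> word_eval G f w"

text \<open>The homomorphism out of a presented group determined by the images of the generators. The
  lemma \<open>pres_lift_hom\<close> below shows that it is well defined as soon as the images satisfy the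
  relations.\<close>

definition pres_lift :: "('a, 'm) monoid_scheme \<Rightarrow> ('g \<Rightarrow> 'a) \<Rightarrow> 'g word set \<Rightarrow> 'a" where
  "pres_lift G f A = the_elem (word_eval G f ` A)"

lemma words_simps [simp]:
  "[] \<in> words S"
  "(a # w) \<in> words S \<longleftrightarrow> fst a \<in> S \<and> w \<in> words S"
  "u @ v \<in> words S \<longleftrightarrow> u \<in> words S \<and> v \<in> words S"
  by (cases a; auto simp: words_def)+

lemma pres_eq_words: "pres_eq S rels u v \<Longrightarrow> u \<in> words S \<and> v \<in> words S"
  by (induction rule: pres_eq.induct) auto

lemma equiv_pres_rel: "equiv (words S) (pres_rel S rels)"
  by (rule equivI)
    (auto simp: pres_rel_def refl_on_def sym_def trans_def
      dest: pres_eq_words intro: pres_eq.refl pres_eq.sym pres_eq.trans)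

lemma pres_eq_context:
  assumes "pres_eq S rels u v" "a \<in> words S" "b \<in> words S"
  shows "pres_eq S rels (a @ u @ b) (a @ v @ b)"
  using assms
proof (induction rule: pres_eq.induct)
  case (cancel u v x c)
  then show ?case using pres_eq.cancel[of "a @ u" S "v @ b" x rels c] by simp
next
  case (rel u v r s)
  then show ?case using pres_eq.rel[of "a @ u" S "v @ b" r s rels] by simp
qed (auto intro: pres_eq.intros)

lemma pres_eq_append:
  assumes "pres_eq S rels u u'" "pres_eq S rels v v'"
  shows "pres_eq S rels (u @ v) (u' @ v')"
proof -
  have "pres_eq S rels ([] @ u @ v) ([] @ u' @ v)"
    using assms by (intro pres_eq_context) (auto dest: pres_eq_words)
  moreover have "pres_eq S rels (u' @ v @ []) (u' @ v' @ [])"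
    using assms by (intro pres_eq_context) (auto dest: pres_eq_words)
  ultimately show ?thesis by (auto intro: pres_eq.trans)
qed

lemma pres_class_eq_iff:
  assumes "u \<in> words S" "v \<in> words S"
  shows "pres_rel S rels `` {u} = pres_rel S rels `` {v} \<longleftrightarrow> pres_eq S rels u v"
  using eq_equiv_class_iff[OF equiv_pres_rel assms, of rels] by (simp add: pres_rel_def)

lemma presented_group_mult:
  assumes "u \<in> words S" "v \<in> words S"
  shows "pres_rel S rels `` {u} \<otimes>\<^bsub>presented_group S rels\<^esub> pres_rel S rels `` {v}
    = pres_rel S rels `` {u @ v}"
proof -
  have "congruent2 (pres_rel S rels) (pres_rel S rels) (\<lambda>u v. pres_rel S rels `` {u @ v})"
  proof (rule congruent2I')
    fix y1 z1 y2 z2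
    assume "(y1, z1) \<in> pres_rel S rels" "(y2, z2) \<in> pres_rel S rels"
    then have e: "pres_eq S rels y1 z1" "pres_eq S rels y2 z2" by (auto simp: pres_rel_def)
    show "pres_rel S rels `` {y1 @ y2} = pres_rel S rels `` {z1 @ z2}"
      using pres_eq_append[OF e] e by (subst pres_class_eq_iff) (auto dest: pres_eq_words)
  qed
  from UN_equiv_class2[OF equiv_pres_rel equiv_pres_rel this assms]
  show ?thesis by (simp add: presented_group_def)
qed

definition word_inv :: "'g word \<Rightarrow> 'g word" where
  "word_inv w = rev (map (\<lambda>(x, b). (x, \<not> b)) w)"

lemma word_inv_in_words: "w \<in> words S \<Longrightarrow> word_inv w \<in> words S"
  by (auto simp: word_inv_def words_def)

lemma word_inv_cancel: "w \<in> words S \<Longrightarrow> pres_eq S rels (word_inv w @ w) []"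
proof (induction w)
  case Nil
  then show ?case by (auto simp: word_inv_def intro: pres_eq.refl)
next
  case (Cons a w)
  obtain x b where a: "a = (x, b)" by (cases a)
  have "word_inv (a # w) @ a # w = word_inv w @ [(x, \<not> b), (x, \<not> \<not> b)] @ w"
    by (simp add: word_inv_def a)
  moreover have "pres_eq S rels (word_inv w @ [(x, \<not> b), (x, \<not> \<not> b)] @ w) (word_inv w @ w)"
    using Cons.prems by (intro pres_eq.cancel) (auto simp: a word_inv_in_words)
  ultimately show ?case using Cons by (auto intro: pres_eq.trans)
qed

lemma presented_group_carrierE:
  assumes "A \<in> carrier (presented_group S rels)"
  obtains w where "w \<in> words S" "A = pres_rel S rels `` {w}"
  using assms by (auto simp: presented_group_def elim: quotientE)

lemma presented_group_carrierI:
  "w \<in> words S \<Longrightarrow> pres_rel S rels `` {w} \<in> carrier (presented_group S rels)"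
  by (auto simp: presented_group_def intro: quotientI)

lemma presented_group_one: "\<one>\<^bsub>presented_group S rels\<^esub> = pres_rel S rels `` {[]}"
  by (simp add: presented_group_def)

lemma group_presented_group: "group (presented_group S rels)"
proof (rule groupI)
  fix A B assume "A \<in> carrier (presented_group S rels)" "B \<in> carrier (presented_group S rels)"
  then show "A \<otimes>\<^bsub>presented_group S rels\<^esub> B \<in> carrier (presented_group S rels)"
    by (auto elim!: presented_group_carrierE simp: presented_group_mult
        intro!: presented_group_carrierI)
next
  fix A B C assume "A \<in> carrier (presented_group S rels)" "B \<in> carrier (presented_group S rels)"
    "C \<in> carrier (presented_group S rels)"
  then show "A \<otimes>\<^bsub>presented_group S rels\<^esub> B \<otimes>\<^bsub>presented_group S rels\<^esub> C
    = A \<otimes>\<^bsub>presented_group S rels\<^esub> (B \<otimes>\<^bsub>presented_group S rels\<^esub> C)"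
    by (auto elim!: presented_group_carrierE simp: presented_group_mult)
next
  fix A assume "A \<in> carrier (presented_group S rels)"
  then obtain w where w: "w \<in> words S" "A = pres_rel S rels `` {w}"
    by (rule presented_group_carrierE)
  show "\<one>\<^bsub>presented_group S rels\<^esub> \<otimes>\<^bsub>presented_group S rels\<^esub> A = A"
    using w by (simp add: presented_group_one presented_group_mult)
  show "\<exists>B\<in>carrier (presented_group S rels).
      B \<otimes>\<^bsub>presented_group S rels\<^esub> A = \<one>\<^bsub>presented_group S rels\<^esub>"
    using w word_inv_cancel[OF w(1), of rels]
    by (intro bexI[of _ "pres_rel S rels `` {word_inv w}"] presented_group_carrierI)
      (auto simp: presented_group_one presented_group_mult word_inv_in_words pres_class_eq_iff)
qed (auto simp: presented_group_one intro: presented_group_carrierI)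

context group
begin

lemma word_eval_closed [simp]:
  assumes "f ` S \<subseteq> carrier G" "w \<in> words S"
  shows "word_eval G f w \<in> carrier G"
  using assms(2,1) by (induction w) auto

lemma word_eval_append:
  assumes "f ` S \<subseteq> carrier G" "u \<in> words S" "v \<in> words S"
  shows "word_eval G f (u @ v) = word_eval G f u \<otimes> word_eval G f v"
  using assms(2)
proof (induction u)
  case Nil
  show ?case using word_eval_closed[OF assms(1,3)] by simp
next
  case (Cons a u)
  obtain x b where a: "a = (x, b)" by (cases a)
  have x: "f x \<in> carrier G" using Cons.prems assms(1) by (auto simp: a)
  have c: "word_eval G f u \<in> carrier G" "word_eval G f v \<in> carrier G"
    using Cons.prems word_eval_closed[OF assms(1)] assms(3) by auto
  show ?case using Cons x c by (simp add: a m_assoc)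
qed

lemma word_eval_cong:
  assumes f: "f ` S \<subseteq> carrier G"
    and rels: "\<And>r s. (r, s) \<in> rels \<Longrightarrow> word_eval G f r = word_eval G f s"
    and "pres_eq S rels u v"
  shows "word_eval G f u = word_eval G f v"
  using assms(3)
proof (induction rule: pres_eq.induct)
  case (cancel u v x b)
  have x: "f x \<in> carrier G" using cancel f by auto
  have "word_eval G f [(x, b), (x, \<not> b)] = \<one>" using x by (cases b) auto
  then show ?case using cancel word_eval_closed[OF f]
    by (simp add: word_eval_append[OF f] del: word_eval.simps append_Cons append.simps)
next
  case (rel u v r s)
  then show ?case using rels by (simp add: word_eval_append[OF f])
qed auto

lemma pres_lift_class:
  assumes f: "f ` S \<subseteq> carrier G"
    and rels: "\<And>r s. (r, s) \<in> rels \<Longrightarrow> word_eval G f r = word_eval G f s"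
    and w: "w \<in> words S"
  shows "pres_lift G f (pres_rel S rels `` {w}) = word_eval G f w"
proof -
  have "word_eval G f ` (pres_rel S rels `` {w}) = {word_eval G f w}"
    using word_eval_cong[OF f rels] pres_eq.refl[OF w] by (fastforce simp: pres_rel_def)
  then show ?thesis by (simp add: pres_lift_def)
qed

theorem pres_lift_hom:
  assumes f: "f ` S \<subseteq> carrier G"
    and rels: "\<And>r s. (r, s) \<in> rels \<Longrightarrow> word_eval G f r = word_eval G f s"
  shows "pres_lift G f \<in> hom (presented_group S rels) G"
proof (rule homI)
  fix A assume "A \<in> carrier (presented_group S rels)"
  then show "pres_lift G f A \<in> carrier G"
    by (auto elim!: presented_group_carrierE simp: pres_lift_class[OF f rels]
        intro!: word_eval_closed[OF f])
next
  fix A B assume "A \<in> carrier (presented_group S rels)" "B \<in> carrier (presented_group S rels)"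
  then show "pres_lift G f (A \<otimes>\<^bsub>presented_group S rels\<^esub> B) = pres_lift G f A \<otimes> pres_lift G f B"
    by (auto elim!: presented_group_carrierE
        simp: pres_lift_class[OF f rels] presented_group_mult word_eval_append[OF f])
qed

end


section \<open>Braid groups and pure braid groups\<close>

definition braid_rels :: "nat \<Rightarrow> (nat word \<times> nat word) set" where
  "braid_rels n =
    {([(i, True), (j, True)], [(j, True), (i, True)]) | i j.
       i \<in> {1..n - 1} \<and> j \<in> {1..n - 1} \<and> (i + 2 \<le> j \<or> j + 2 \<le> i)} \<union>
    {([(i, True), (i + 1, True), (i, True)], [(i + 1, True), (i, True), (i + 1, True)]) | i.
       1 \<le> i \<and> i + 2 \<le> n}"

definition braid_group :: "nat \<Rightarrow> nat word set monoid" where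
  "braid_group n = presented_group {1..n - 1} (braid_rels n)"

definition braid_perm :: "nat \<Rightarrow> nat word set \<Rightarrow> nat \<Rightarrow> nat" where
  "braid_perm n = pres_lift (sym_group n) (\<lambda>i. transpose i (i + 1))"

definition pure_braids :: "nat \<Rightarrow> nat word set set" where
  "pure_braids n = kernel (braid_group n) (sym_group n) (braid_perm n)"


section \<open>The representation\<close>

text \<open>The ``left into right'' tensor product: a block matrix whose block at position
  \<open>(k, l)\<close> is \<open>A $$ (k, l)\<close> times \<open>M\<close>.\<close>

definition tensor_mat :: "'a::semiring_1 mat \<Rightarrow> 'a mat \<Rightarrow> 'a mat" where
  "tensor_mat M A = mat (dim_row M * dim_row A) (dim_col M * dim_col A)
    (\<lambda>(i, j). A $$ (i div dim_row M, j div dim_col M) * M $$ (i mod dim_row M, j mod dim_col M))"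

primrec tensor_pow :: "'a::semiring_1 mat \<Rightarrow> nat \<Rightarrow> 'a mat" where
  "tensor_pow M 0 = 1\<^sub>m 1"
| "tensor_pow M (Suc k) = tensor_mat (tensor_pow M k) M"

definition R_mat :: "complex mat" where
  "R_mat = complex_of_real (1 / sqrt 2) \<cdot>\<^sub>m mat_of_rows_list 4
    [[1, 0, 0, 1],
     [0, 1, -1, 0],
     [0, 1, 1, 0],
     [-1, 0, 0, 1]]"

definition rep_gen :: "nat \<Rightarrow> nat \<Rightarrow> complex mat" where
  "rep_gen n i =
    tensor_mat (tensor_mat (tensor_pow (1\<^sub>m 2) (i - 1)) R_mat) (tensor_pow (1\<^sub>m 2) (n - i - 1))"

text \<open>The general linear group of \<open>(\<complex>\<^sup>2)\<^sup>\<otimes>\<^sup>n\<close>, as matrices of size \<open>2 ^ n\<close>.\<close>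

definition GL_tensor :: "nat \<Rightarrow> complex mat monoid" where
  "GL_tensor n = units_of (ring_mat TYPE(complex) (2 ^ n) ())"

definition braid_rep :: "nat \<Rightarrow> nat word set \<Rightarrow> complex mat" where
  "braid_rep n = pres_lift (GL_tensor n) (rep_gen n)"

definition G_grp :: "nat \<Rightarrow> complex mat monoid" where
  "G_grp n = (GL_tensor n)\<lparr>carrier := braid_rep n ` carrier (braid_group n)\<rparr>"

definition H_grp :: "nat \<Rightarrow> complex mat monoid" where
  "H_grp n = (GL_tensor n)\<lparr>carrier := braid_rep n ` pure_braids n\<rparr>"


section \<open>Short exact sequences\<close>

text \<open>The library predicate \<open>exact_seq\<close> requires all groups to have elements of one type.\<close>

definition short_exact_seq ::
  "'a monoid \<Rightarrow> ('a \<Rightarrow> 'b) \<Rightarrow> 'b monoid \<Rightarrow> ('b \<Rightarrow> 'c) \<Rightarrow> 'c monoid \<Rightarrow> bool" where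
  "short_exact_seq A f B g C \<longleftrightarrow>
    group A \<and> group B \<and> group C \<and>
    f \<in> mon A B \<and> g \<in> epi B C \<and> f ` carrier A = kernel B C g"


section \<open>Well-definedness of the homomorphisms\<close>

lemma group_braid_group: "group (braid_group n)"
  unfolding braid_group_def by (rule group_presented_group)

lemma braid_perm_hom: "braid_perm n \<in> hom (braid_group n) (sym_group n)"
proof -
  interpret group "sym_group n" by (rule sym_group_is_group)
  have *: "transpose i (Suc i) permutes {1..n}" if "1 \<le> i" "i \<le> n - 1" for i
    using that by (intro permutes_swap_id) auto
  show ?thesis
    unfolding braid_perm_def braid_group_def
  proof (rule pres_lift_hom)
    show "(\<lambda>i. transpose i (i + 1)) ` {1..n - 1} \<subseteq> carrier (sym_group n)"
      using * by (auto simp: sym_group_carrier)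
  qed (auto simp: braid_rels_def sym_group_mult sym_group_one fun_eq_iff transpose_def)
qed

lemma group_GL_tensor: "group (GL_tensor n)"
proof -
  interpret ring "ring_mat TYPE(complex) (2 ^ n) ()" by (rule ring_mat)
  show ?thesis unfolding GL_tensor_def by (rule units_group)
qed

lemma dim_tensor_mat [simp]:
  "dim_row (tensor_mat M A) = dim_row M * dim_row A"
  "dim_col (tensor_mat M A) = dim_col M * dim_col A"
  by (simp_all add: tensor_mat_def)

lemma tensor_mat_mult:
  fixes M N A B :: "complex mat"
  assumes "dim_col M = dim_row N" "dim_col A = dim_row B"
  shows "tensor_mat M A * tensor_mat N B = tensor_mat (M * N) (A * B)"
proof (rule eq_matI)
  fix i j
  assume "i < dim_row (tensor_mat (M * N) (A * B))" "j < dim_col (tensor_mat (M * N) (A * B))"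
  then have i: "i < dim_row M * dim_row A" and j: "j < dim_col N * dim_col B" by simp_all
  define d e where "d = dim_row N" and "e = dim_row B"
  have i': "i div dim_row M < dim_row A" "i mod dim_row M < dim_row M"
    using i by (auto simp: less_mult_imp_div_less mult.commute intro!: mod_less_divisor Nat.gr0I)
  have j': "j div dim_col N < dim_col B" "j mod dim_col N < dim_col N"
    using j by (auto simp: less_mult_imp_div_less mult.commute intro!: mod_less_divisor Nat.gr0I)
  have "(tensor_mat M A * tensor_mat N B) $$ (i, j) =
     (\<Sum>k<d * e. (A $$ (i div dim_row M, k div d) * M $$ (i mod dim_row M, k mod d)) *
       (B $$ (k div d, j div dim_col N) * N $$ (k mod d, j mod dim_col N)))"
    using i j assms by (auto simp: scalar_prod_def tensor_mat_def d_def e_def lessThan_atLeast0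
        intro!: sum.cong)
  also have "\<dots> = (\<Sum>(a, b)\<in>{..<e} \<times> {..<d}.
       (A $$ (i div dim_row M, a) * M $$ (i mod dim_row M, b)) *
       (B $$ (a, j div dim_col N) * N $$ (b, j mod dim_col N)))"
  proof (rule sum.reindex_bij_witness[where i = "\<lambda>(a, b). a * d + b" and j = "\<lambda>k. (k div d, k mod d)"])
    fix k assume "k \<in> {..<d * e}"
    then have "k < d * e" by simp
    then show "(k div d, k mod d) \<in> {..<e} \<times> {..<d}"
      by (auto simp: less_mult_imp_div_less mult.commute intro!: mod_less_divisor Nat.gr0I)
  next
    fix p assume "p \<in> {..<e} \<times> {..<d}"
    then obtain a b where p: "p = (a, b)" "a < e" "b < d" by auto
    have "a * d + b < Suc a * d" using p by simp
    also have "\<dots> \<le> e * d" using p by (intro mult_le_mono1) simp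
    finally show "(case p of (a, b) \<Rightarrow> a * d + b) \<in> {..<d * e}" using p by (simp add: mult.commute)
  qed auto
  also have "\<dots> = (\<Sum>a<e. A $$ (i div dim_row M, a) * B $$ (a, j div dim_col N)) *
      (\<Sum>b<d. M $$ (i mod dim_row M, b) * N $$ (b, j mod dim_col N))"
    by (simp add: sum_product sum.cartesian_product algebra_simps)
  also have "\<dots> = tensor_mat (M * N) (A * B) $$ (i, j)"
    using i j i' j' assms
    by (simp add: tensor_mat_def scalar_prod_def d_def e_def lessThan_atLeast0)
  finally show "(tensor_mat M A * tensor_mat N B) $$ (i, j) = tensor_mat (M * N) (A * B) $$ (i, j)" .
qed (simp_all add: assms)

lemma tensor_mat_assoc:
  fixes A B C :: "complex mat"
  shows "tensor_mat (tensor_mat A B) C = tensor_mat A (tensor_mat B C)"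
proof (rule eq_matI)
  fix i j
  assume "i < dim_row (tensor_mat A (tensor_mat B C))" "j < dim_col (tensor_mat A (tensor_mat B C))"
  then have i: "i < dim_row A * dim_row B * dim_row C"
    and j: "j < dim_col A * dim_col B * dim_col C" by (simp_all add: mult.assoc)
  have pos: "0 < dim_row A" "0 < dim_row B" "0 < dim_col A" "0 < dim_col B"
    using i j by (auto intro!: Nat.gr0I)
  have b: "k mod (a * b) < a * b" "k div a < b * c" "k mod (a * b) div a = k div a mod b"
    "k mod (a * b) mod a = k mod a" "k div (a * b) = k div a div b"
    if "k < a * b * c" "0 < a" "0 < b" for a b c k :: nat
  proof -
    show "k mod (a * b) < a * b" using that by simp
    have "k < b * c * a" using that by (simp add: ac_simps)
    then show "k div a < b * c" by (rule less_mult_imp_div_less)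
  qed (use that in \<open>simp_all add: mod_mult2_eq div_mult2_eq\<close>)
  show "tensor_mat (tensor_mat A B) C $$ (i, j) = tensor_mat A (tensor_mat B C) $$ (i, j)"
    using i j b[OF i pos(1,2)] b[OF j pos(3,4)]
    by (simp add: tensor_mat_def mult.assoc)
qed (simp_all add: mult.assoc)

lemma tensor_mat_one: "tensor_mat (1\<^sub>m a) (1\<^sub>m b) = (1\<^sub>m (a * b) :: complex mat)"
proof (rule eq_matI)
  fix i j assume "i < dim_row (1\<^sub>m (a * b) :: complex mat)" "j < dim_col (1\<^sub>m (a * b) :: complex mat)"
  then have i: "i < a * b" and j: "j < a * b" by simp_all
  have "i div a < b" "j div a < b" "i mod a < a" "j mod a < a"
    using i j by (auto simp: less_mult_imp_div_less mult.commute intro!: mod_less_divisor Nat.gr0I)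
  moreover have "i = j \<longleftrightarrow> i div a = j div a \<and> i mod a = j mod a"
    by (metis div_mult_mod_eq)
  ultimately show "tensor_mat (1\<^sub>m a) (1\<^sub>m b) $$ (i, j) = (1\<^sub>m (a * b) :: complex mat) $$ (i, j)"
    using i j by (auto simp: tensor_mat_def)
qed simp_all

lemma tensor_pow_one: "tensor_pow (1\<^sub>m 2) k = (1\<^sub>m (2 ^ k) :: complex mat)"
  by (induction k) (simp_all add: tensor_mat_one mult.commute)

lemma dim_R_mat [simp]: "dim_row R_mat = 4" "dim_col R_mat = 4"
  by (simp_all add: R_mat_def mat_of_rows_list_def)

definition embed_mat :: "nat \<Rightarrow> complex mat \<Rightarrow> nat \<Rightarrow> complex mat" where
  "embed_mat a A b = tensor_mat (tensor_mat (1\<^sub>m (2 ^ a)) A) (1\<^sub>m (2 ^ b))"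

lemma rep_gen_embed: "rep_gen n i = embed_mat (i - 1) R_mat (n - i - 1)"
  by (simp add: rep_gen_def embed_mat_def tensor_pow_one)

lemma embed_mat_mult:
  assumes "dim_col A = dim_row B"
  shows "embed_mat a A b * embed_mat a B b = embed_mat a (A * B) b"
  using assms by (simp add: embed_mat_def tensor_mat_mult)

lemma embed_mat_left: "embed_mat (a + c) A b = embed_mat a (tensor_mat (1\<^sub>m (2 ^ c)) A) b"
  by (simp add: embed_mat_def tensor_mat_assoc power_add flip: tensor_mat_one)

lemma embed_mat_right: "embed_mat a A (c + b) = embed_mat a (tensor_mat A (1\<^sub>m (2 ^ c))) b"
  by (simp add: embed_mat_def tensor_mat_assoc power_add flip: tensor_mat_one)

lemma R_mat_inverse: "R_mat * R_mat\<^sup>T = 1\<^sub>m 4" "R_mat\<^sup>T * R_mat = 1\<^sub>m 4"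
proof -
  have s: "complex_of_real (sqrt 2) * complex_of_real (sqrt 2) = 2"
    by (simp flip: of_real_mult)
  show "R_mat * R_mat\<^sup>T = 1\<^sub>m 4" "R_mat\<^sup>T * R_mat = 1\<^sub>m 4"
    by (rule eq_matI; simp add: R_mat_def mat_of_rows_list_def;
        auto simp: scalar_prod_def less_Suc_eq numeral_eq_Suc field_simps s)+
qed

lemma braid_of_anticommuting:
  fixes U V :: "complex mat"
  assumes U: "U \<in> carrier_mat m m" and V: "V \<in> carrier_mat m m"
    and UU: "U * U = - 1\<^sub>m m" and anti: "U * V = - (V * U)"
  shows "(1\<^sub>m m + U) * (1\<^sub>m m + V) * (1\<^sub>m m + U) = 2 \<cdot>\<^sub>m (U + V)"
proof -
  have UV: "U * V \<in> carrier_mat m m" and VU: "V * U \<in> carrier_mat m m" using U V by auto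
  have UVU: "U * V * U = V"
  proof -
    have "U * V * U = - (V * U * U)"
      using U VU by (simp add: anti)
    also have "V * U * U = V * (- 1\<^sub>m m)"
      using U V by (simp add: assoc_mult_mat[of V m m U m U m] UU)
    also have "V * (- 1\<^sub>m m) = - V" using V by simp
    finally show ?thesis using V by (intro eq_matI) auto
  qed
  have expand: "(1\<^sub>m m + P) * (1\<^sub>m m + Q) = (1\<^sub>m m + Q) + (P + P * Q)"
    if P: "P \<in> carrier_mat m m" and Q: "Q \<in> carrier_mat m m" for P Q :: "complex mat"
  proof -
    have "(1\<^sub>m m + P) * (1\<^sub>m m + Q) = 1\<^sub>m m * (1\<^sub>m m + Q) + P * (1\<^sub>m m + Q)"
      using P Q by (intro add_mult_distrib_mat[where nr = m and n = m and nc = m]) auto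
    also have "1\<^sub>m m * (1\<^sub>m m + Q) = 1\<^sub>m m + Q" using Q by (intro left_mult_one_mat) auto
    also have "P * (1\<^sub>m m + Q) = P * 1\<^sub>m m + P * Q"
      using P Q by (intro mult_add_distrib_mat[where nr = m and n = m and nc = m]) auto
    also have "P * 1\<^sub>m m = P" using P by (rule right_mult_one_mat)
    finally show ?thesis .
  qed
  have "(1\<^sub>m m + U) * (1\<^sub>m m + V) = (1\<^sub>m m + V) + (U + U * V)"
    using U V by (rule expand)
  also have "\<dots> * (1\<^sub>m m + U) = (1\<^sub>m m + V) * (1\<^sub>m m + U) + (U + U * V) * (1\<^sub>m m + U)"
    using U V UV by (simp add: add_mult_distrib_mat[of "1\<^sub>m m + V" m m "U + U * V" "1\<^sub>m m + U" m])
  also have "(1\<^sub>m m + V) * (1\<^sub>m m + U) = (1\<^sub>m m + U) + (V + V * U)"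
    using V U by (rule expand)
  also have "(U + U * V) * (1\<^sub>m m + U) = (U - 1\<^sub>m m) + (U * V + V)"
  proof -
    have "(U + U * V) * (1\<^sub>m m + U) = U * (1\<^sub>m m + U) + U * V * (1\<^sub>m m + U)"
      using U UV by (intro add_mult_distrib_mat[where nr = m and n = m and nc = m]) auto
    also have "U * (1\<^sub>m m + U) = U - 1\<^sub>m m"
      using U by (simp add: mult_add_distrib_mat[of U m m _ m] UU) (intro eq_matI; auto)
    also have "U * V * (1\<^sub>m m + U) = U * V + V"
      using U UV UVU by (simp add: mult_add_distrib_mat[of "U * V" m m _ m U] right_mult_one_mat[of "U * V" m m])
    finally show ?thesis .
  qed
  also have "U * V = - (V * U)" by (rule anti)
  also have "1\<^sub>m m + U + (V + V * U) + (U - 1\<^sub>m m + (- (V * U) + V)) = 2 \<cdot>\<^sub>m (U + V)"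
    using U V VU by (intro eq_matI) auto
  finally show ?thesis .
qed

lemma index_tensor_mat:
  assumes "i < dim_row M * dim_row A" "j < dim_col M * dim_col A"
  shows "tensor_mat M A $$ (i, j) =
    A $$ (i div dim_row M, j div dim_col M) * M $$ (i mod dim_row M, j mod dim_col M)"
  using assms by (simp add: tensor_mat_def)

lemma div_mod_bounds:
  assumes "i < a * (b :: nat)"
  shows "i div a < b" "i mod a < a"
proof -
  have "i < b * a" using assms by (simp only: mult.commute)
  then show "i div a < b" by (rule less_mult_imp_div_less)
  have "a \<noteq> 0" using assms by (intro notI) simp
  then show "i mod a < a" by simp
qed

lemma tensor_bounds:
  assumes "i < a * (b :: nat)" "j < c * (d :: nat)"
  shows "i div a < b \<and> i mod a < a \<and> j div c < d \<and> j mod c < c"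
  using assms by (simp add: div_mod_bounds(1) div_mod_bounds(2)[OF assms(1)] div_mod_bounds(2)[OF assms(2)])

lemma tensor_mat_uminus:
  fixes A B :: "complex mat"
  shows "tensor_mat (- A) B = - tensor_mat A B" "tensor_mat A (- B) = - tensor_mat A B"
  by (rule eq_matI; simp add: index_tensor_mat; frule (1) tensor_bounds; simp)+

lemma tensor_mat_smult:
  fixes A B :: "complex mat"
  shows "tensor_mat (s \<cdot>\<^sub>m A) B = s \<cdot>\<^sub>m tensor_mat A B" "tensor_mat A (s \<cdot>\<^sub>m B) = s \<cdot>\<^sub>m tensor_mat A B"
  by (rule eq_matI; simp add: index_tensor_mat; frule (1) tensor_bounds; simp)+

lemma tensor_mat_add:
  fixes A B C :: "complex mat"
  assumes "dim_row A = dim_row B" "dim_col A = dim_col B"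
  shows "tensor_mat (A + B) C = tensor_mat A C + tensor_mat B C"
    "tensor_mat C (A + B) = tensor_mat C A + tensor_mat C B"
  by (rule eq_matI; simp add: index_tensor_mat assms; frule (1) tensor_bounds;
      simp add: algebra_simps assms)+

lemma R_mat_yang_baxter:
  "tensor_mat R_mat (1\<^sub>m 2) * tensor_mat (1\<^sub>m 2) R_mat * tensor_mat R_mat (1\<^sub>m 2) =
   tensor_mat (1\<^sub>m 2) R_mat * tensor_mat R_mat (1\<^sub>m 2) * tensor_mat (1\<^sub>m 2) R_mat"
proof -
  define s where "s = complex_of_real (1 / sqrt 2)"
  define K L :: "complex mat" where
    "K = mat_of_rows_list 2 [[0, 1], [-1, 0]]" and "L = mat_of_rows_list 2 [[0, 1], [1, 0]]"
  define J where "J = tensor_mat K L"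
  have dims [simp]: "dim_row K = 2" "dim_col K = 2" "dim_row L = 2" "dim_col L = 2"
    "dim_row J = 4" "dim_col J = 4"
    by (simp_all add: K_def L_def J_def mat_of_rows_list_def)
  have all4: "i < 4 \<longleftrightarrow> i = 0 \<or> i = 1 \<or> i = 2 \<or> i = 3" for i :: nat by auto
  have KK: "K * K = - 1\<^sub>m 2" and LL: "L * L = 1\<^sub>m 2" and LK: "L * K = - (K * L)"
    by (rule eq_matI; auto simp: K_def L_def mat_of_rows_list_def scalar_prod_def
        numeral_2_eq_2 less_Suc_eq)+
  have K: "K $$ (0, 0) = 0" "K $$ (0, Suc 0) = 1" "K $$ (Suc 0, 0) = - 1" "K $$ (Suc 0, Suc 0) = 0"
    and L: "L $$ (0, 0) = 0" "L $$ (0, Suc 0) = 1" "L $$ (Suc 0, 0) = 1" "L $$ (Suc 0, Suc 0) = 0"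
    by (simp_all add: K_def L_def mat_of_rows_list_def)
  have R: "R_mat = s \<cdot>\<^sub>m (1\<^sub>m 4 + J)"
    by (rule eq_matI; simp; auto simp: R_mat_def s_def J_def tensor_mat_def K L
        mat_of_rows_list_def all4)
  define U V where "U = tensor_mat J (1\<^sub>m 2)" and "V = tensor_mat (1\<^sub>m 2) J"
  have c: "U \<in> carrier_mat 8 8" "V \<in> carrier_mat 8 8"
    by (auto simp: U_def V_def intro!: carrier_matI)
  have id: "K * 1\<^sub>m 2 = K" "1\<^sub>m 2 * K = K" "L * 1\<^sub>m 2 = L" "1\<^sub>m 2 * L = L"
    by (auto intro!: right_mult_one_mat left_mult_one_mat carrier_matI)
  have JJ: "J * J = - 1\<^sub>m 4"
    by (simp add: J_def tensor_mat_mult KK LL tensor_mat_uminus tensor_mat_one)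
  have UU: "U * U = - 1\<^sub>m 8" and VV: "V * V = - 1\<^sub>m 8"
    by (simp_all add: U_def V_def tensor_mat_mult JJ tensor_mat_uminus tensor_mat_one)
  have "U * V = tensor_mat K (tensor_mat (L * K) L)"
    by (simp add: U_def V_def J_def tensor_mat_assoc tensor_mat_mult id)
  moreover have "V * U = tensor_mat K (tensor_mat (K * L) L)"
    by (simp add: U_def V_def J_def tensor_mat_assoc tensor_mat_mult id)
  ultimately have anti: "U * V = - (V * U)" by (simp add: LK tensor_mat_uminus)
  have anti': "V * U = - (U * V)" unfolding anti using c by (intro eq_matI) auto
  have lin: "tensor_mat (s \<cdot>\<^sub>m (1\<^sub>m 4 + J)) (1\<^sub>m 2) = s \<cdot>\<^sub>m (1\<^sub>m 8 + U)"
    "tensor_mat (1\<^sub>m 2) (s \<cdot>\<^sub>m (1\<^sub>m 4 + J)) = s \<cdot>\<^sub>m (1\<^sub>m 8 + V)"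
    by (simp_all add: tensor_mat_smult tensor_mat_add tensor_mat_one U_def V_def)
  have smult: "(x \<cdot>\<^sub>m P) * (y \<cdot>\<^sub>m Q) = (x * y) \<cdot>\<^sub>m (P * Q)"
    if "P \<in> carrier_mat 8 8" "Q \<in> carrier_mat 8 8" for x y and P Q :: "complex mat"
    using that by (intro eq_matI) auto
  have "U + V = V + U" using c by (rule comm_add_mat)
  then show ?thesis
    unfolding R lin
    using c braid_of_anticommuting[OF c UU anti] braid_of_anticommuting[OF c(2,1) VV anti']
    by (simp add: smult mult_carrier_mat[of _ 8 8 _ 8])
qed

lemma rep_gen_commute:
  assumes "1 \<le> i" "i + 2 \<le> j" "j \<le> n - 1"
  shows "rep_gen n i * rep_gen n j = rep_gen n j * rep_gen n i"
proof -
  define c where "c = j - i - 2"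
  have j: "j - 1 = (i - 1) + (c + 2)" and n: "n - i - 1 = (c + 2) + (n - j - 1)"
    using assms by (auto simp: c_def)
  have p: "(2::nat) ^ (c + 2) = 2 ^ c * 4" by simp
  let ?L = "tensor_mat R_mat (tensor_mat (1\<^sub>m (2 ^ c)) (1\<^sub>m 4))"
  let ?R = "tensor_mat (1\<^sub>m 4) (tensor_mat (1\<^sub>m (2 ^ c)) R_mat)"
  have i: "rep_gen n i = embed_mat (i - 1) ?L (n - j - 1)"
    unfolding rep_gen_embed n embed_mat_right p tensor_mat_one by simp
  have "(1\<^sub>m (2 ^ (c + 2)) :: complex mat) = tensor_mat (1\<^sub>m 4) (1\<^sub>m (2 ^ c))"
    by (simp add: power_add tensor_mat_one mult.commute)
  then have j: "rep_gen n j = embed_mat (i - 1) ?R (n - j - 1)"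
    unfolding rep_gen_embed j embed_mat_left by (simp add: tensor_mat_assoc)
  have "R_mat * 1\<^sub>m 4 = R_mat" "1\<^sub>m 4 * R_mat = R_mat"
    by (auto intro!: right_mult_one_mat left_mult_one_mat carrier_matI)
  then have "?L * ?R = ?R * ?L"
    by (simp add: tensor_mat_mult)
  then show ?thesis by (simp add: i j embed_mat_mult)
qed

lemma rep_gen_braid:
  assumes "1 \<le> i" "i + 2 \<le> n"
  shows "rep_gen n i * rep_gen n (i + 1) * rep_gen n i =
    rep_gen n (i + 1) * rep_gen n i * rep_gen n (i + 1)"
proof -
  have j: "i + 1 - 1 = (i - 1) + 1" and n: "n - i - 1 = 1 + (n - i - 2)" "n - (i + 1) - 1 = n - i - 2"
    using assms by auto
  have "rep_gen n i = embed_mat (i - 1) (tensor_mat R_mat (1\<^sub>m 2)) (n - i - 2)"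
    unfolding rep_gen_embed n embed_mat_right by simp
  moreover have "rep_gen n (i + 1) = embed_mat (i - 1) (tensor_mat (1\<^sub>m 2) R_mat) (n - i - 2)"
    unfolding rep_gen_embed n j embed_mat_left by simp
  ultimately show ?thesis
    using R_mat_yang_baxter by (simp add: embed_mat_mult)
qed

lemma embed_mat_carrier:
  assumes "dim_row A = 4" "dim_col A = 4" "1 \<le> i" "i \<le> n - 1"
  shows "embed_mat (i - 1) A (n - i - 1) \<in> carrier_mat (2 ^ n) (2 ^ n)"
proof -
  have "n = (i - 1) + 2 + (n - i - 1)" using assms by simp
  then have "(2::nat) ^ n = 2 ^ (i - 1) * 4 * 2 ^ (n - i - 1)"
    by (metis power_add power2_eq_square mult_2 numeral_Bit0)
  then show ?thesis using assms by (auto simp: embed_mat_def intro!: carrier_matI)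
qed

lemma GL_tensor_mult: "x \<otimes>\<^bsub>GL_tensor n\<^esub> y = x * y"
  by (simp add: GL_tensor_def units_of_def ring_mat_def)

lemma rep_gen_in_GL:
  assumes "1 \<le> i" "i \<le> n - 1"
  shows "rep_gen n i \<in> carrier (GL_tensor n)"
proof -
  have n: "n = (i - 1) + 2 + (n - i - 1)" using assms by simp
  have "(2::nat) ^ n = 2 ^ (i - 1) * 4 * 2 ^ (n - i - 1)"
    by (subst n) (simp add: power_add)
  then have one: "embed_mat (i - 1) (1\<^sub>m 4) (n - i - 1) = 1\<^sub>m (2 ^ n)"
    by (simp add: embed_mat_def tensor_mat_one)
  note one' = one[simplified]
  show ?thesis
    using assms embed_mat_carrier[of R_mat i n] embed_mat_carrier[of "R_mat\<^sup>T" i n]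
    by (auto simp: GL_tensor_def units_of_def Units_def ring_mat_def rep_gen_embed
        embed_mat_mult R_mat_inverse one'
        intro!: bexI[of _ "embed_mat (i - 1) (R_mat\<^sup>T) (n - i - 1)"])
qed

lemma braid_rep_hom: "braid_rep n \<in> hom (braid_group n) (GL_tensor n)"
proof -
  interpret group "GL_tensor n" by (rule group_GL_tensor)
  have c: "rep_gen n ` {1..n - 1} \<subseteq> carrier (GL_tensor n)"
    by (auto intro!: rep_gen_in_GL)
  show ?thesis
    unfolding braid_rep_def braid_group_def
  proof (rule pres_lift_hom[OF c])
    fix r s assume "(r, s) \<in> braid_rels n"
    then show "word_eval (GL_tensor n) (rep_gen n) r = word_eval (GL_tensor n) (rep_gen n) s"
      unfolding braid_rels_def
    proof (elim UnE CollectE exE conjE)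
      fix i j
      assume "(r, s) = ([(i, True), (j, True)], [(j, True), (i, True)])"
        and ij: "i \<in> {1..n - 1}" "j \<in> {1..n - 1}" "i + 2 \<le> j \<or> j + 2 \<le> i"
      moreover have "rep_gen n i \<otimes>\<^bsub>GL_tensor n\<^esub> rep_gen n j = rep_gen n j \<otimes>\<^bsub>GL_tensor n\<^esub> rep_gen n i"
        using ij rep_gen_commute[of i j n] rep_gen_commute[of j i n] by (auto simp: GL_tensor_mult)
      moreover have "rep_gen n i \<in> carrier (GL_tensor n)" "rep_gen n j \<in> carrier (GL_tensor n)"
        using ij by (auto intro!: rep_gen_in_GL)
      ultimately show ?thesis by simp
    next
      fix i
      assume "(r, s) = ([(i, True), (i + 1, True), (i, True)], [(i + 1, True), (i, True), (i + 1, True)])"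
        and i: "1 \<le> i" "i + 2 \<le> n"
      moreover have "rep_gen n i \<in> carrier (GL_tensor n)" "rep_gen n (i + 1) \<in> carrier (GL_tensor n)"
        using i by (auto intro!: rep_gen_in_GL)
      moreover note rep_gen_braid[OF i, folded GL_tensor_mult[of n]]
      ultimately show ?thesis
        by (simp add: m_assoc)
    qed
  qed
qed

end

theory Submission
  imports Defs
begin

text \<open>The image \<open>G\<^sub>n\<close> carries a homomorphism onto \<open>S\<^sub>n\<close> with kernel \<open>H\<^sub>n\<close> as soon as the kernel of
  the representation consists of pure braids. To see the latter, consider the Jordan-Wigner matrices
  \<open>\<gamma>\<^sub>a = Z \<otimes> \<dots> \<otimes> Z \<otimes> X \<otimes> I \<otimes> \<dots> \<otimes> I\<close> (with \<open>X\<close> in position \<open>a\<close>). Conjugation by \<open>\<pi>\<^sub>n(\<sigma>\<^sub>i)\<close> permutes them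
  up to scalars by the transposition \<open>(i, i + 1)\<close>. Hence a braid with trivial image induces a
  permutation that fixes every line \<open>\<complex>\<gamma>\<^sub>a\<close>, and these lines are pairwise distinct.\<close>

section \<open>Group theory\<close>

text \<open>Because the kernel of \<open>f\<close> lies in that of \<open>p\<close>,
  \<open>p\<close> factors through \<open>f\<close>. The induced map inherits surjectivity from
  \<open>p\<close>, and its kernel is the \<open>f\<close>-image of the kernel of
  \<open>p\<close>.\<close>

lemma short_exact_seq_image:
  fixes L :: "'b monoid" and S :: "'c monoid"
  assumes f: "group_hom B L f" and p: "group_hom B S p"
    and surj: "p ` carrier B = carrier S"
    and ker: "kernel B L f \<subseteq> kernel B S p"
  defines "G \<equiv> L\<lparr>carrier := f ` carrier B\<rparr>"
    and "H \<equiv> L\<lparr>carrier := f ` kernel B S p\<rparr>"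
  shows "carrier H \<lhd> G \<and> (\<exists>\<phi>. short_exact_seq H (\<lambda>x. x) G \<phi> S)"
proof -
  interpret f: group_hom B L f by (rule f)
  interpret p: group_hom B S p by (rule p)
  have group_G: "group G"
    unfolding G_def by (intro f.H.subgroup_imp_group f.img_is_subgroup)
  have group_H: "group H"
    unfolding H_def by (intro f.H.subgroup_imp_group f.subgroup_img_is_subgroup p.subgroup_kernel)
  have p_eq: "p x = p y" if x: "x \<in> carrier B" and y: "y \<in> carrier B" and "f x = f y" for x y
  proof -
    have "x \<otimes>\<^bsub>B\<^esub> inv\<^bsub>B\<^esub> y \<in> kernel B L f"
      using that by (simp add: kernel_def)
    then have "p (x \<otimes>\<^bsub>B\<^esub> inv\<^bsub>B\<^esub> y) = \<one>\<^bsub>S\<^esub>"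
      using ker by (auto simp: kernel_def)
    then show ?thesis
      using x y by (simp add: p.H.inv_solve_right')
  qed
  \<comment> \<open>\<open>inv_into\<close> picks an arbitrary \<open>f\<close>-preimage;
    \<open>p_eq\<close> makes the value independent of the choice.\<close>
  define \<phi> where "\<phi> = (\<lambda>y. p (inv_into (carrier B) f y))"
  have \<phi>: "\<phi> (f x) = p x" if "x \<in> carrier B" for x
    unfolding \<phi>_def using that by (intro p_eq) (auto intro: inv_into_into f_inv_into_f)
  have hom: "\<phi> \<in> hom G S"
    by (rule homI) (auto simp: G_def \<phi> simp flip: f.hom_mult)
  have ker_\<phi>: "kernel G S \<phi> = f ` kernel B S p"
    by (auto simp: kernel_def G_def \<phi>)
  interpret \<phi>: group_hom G S \<phi>
    using group_G hom by (simp add: group_hom_def group_hom_axioms_def)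
  have "\<phi> \<in> epi G S"
    using hom surj by (auto simp: epi_def G_def image_image \<phi>)
  moreover have "(\<lambda>x. x) \<in> mon H G"
    by (auto simp: mon_def hom_def H_def G_def inj_on_def kernel_def simp flip: f.hom_mult)
  moreover have "carrier H = kernel G S \<phi>"
    by (simp add: ker_\<phi> H_def)
  ultimately show ?thesis
    using \<phi>.normal_kernel group_G group_H p.H.group_axioms
    unfolding short_exact_seq_def by auto
qed

section \<open>Generation of the symmetric group\<close>

text \<open>Conjugating by an adjacent transposition lengthens a transposition by one; a < b ensures
  that \<open>a\<close> stays fixed.\<close>

lemma transpose_Suc_conj:
  assumes "a < b"
  shows "transpose a (Suc b) = transpose b (Suc b) \<circ> (transpose a b \<circ> transpose b (Suc b))"
  using assms by (auto simp: fun_eq_iff transpose_def)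

lemma sym_group_generated_by_adjacent:
  assumes C: "id \<in> C" "\<And>p q. p \<in> C \<Longrightarrow> q \<in> C \<Longrightarrow> p \<circ> q \<in> C"
    and adj: "\<And>i. 1 \<le> i \<Longrightarrow> i < n \<Longrightarrow> transpose i (Suc i) \<in> C"
  shows "carrier (sym_group n) \<subseteq> C"
proof
  have less: "transpose a b \<in> C" if "1 \<le> a" "Suc a \<le> b" "b \<le> n" for a b
    using that(2,3)
  proof (induction b rule: dec_induct)
    case base
    then show ?case using that by (intro adj) auto
  next
    case (step b)
    then show ?case
      using that by (subst transpose_Suc_conj) (auto intro!: C(2) adj)
  qed
  have trans: "transpose a b \<in> C" if "a \<in> {1..n}" "b \<in> {1..n}" "a \<noteq> b" for a b
    using that less[of a b] less[of b a]
    by (cases "a < b") (auto simp: transpose_commute[of a b])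
  fix p assume "p \<in> carrier (sym_group n)"
  then have "p permutes {1..n}" by (simp add: sym_group_carrier)
  then show "p \<in> C"
    using finite_atLeastAtMost
    by (induction rule: permutes_induct) (blast intro: C trans)+
qed

section \<open>Images of braid words\<close>

lemma transpose_in_sym_group:
  "(\<lambda>i. transpose i (i + 1)) ` {1..n - 1} \<subseteq> carrier (sym_group n)"
  by (auto simp: sym_group_carrier intro!: permutes_swap_id)

lemma braid_perm_class:
  assumes "w \<in> words {1..n - 1}"
  shows "braid_perm n (pres_rel {1..n - 1} (braid_rels n) `` {w}) =
    word_eval (sym_group n) (\<lambda>i. transpose i (i + 1)) w"
proof -
  interpret group "sym_group n" by (rule sym_group_is_group)
  show ?thesis
    unfolding braid_perm_def using transpose_in_sym_group _ assms
    by (rule pres_lift_class)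
      (auto simp: braid_rels_def sym_group_mult sym_group_one fun_eq_iff transpose_def)
qed

lemma rep_gen_image_in_GL: "rep_gen n ` {1..n - 1} \<subseteq> carrier (GL_tensor n)"
  by (auto intro!: rep_gen_in_GL)

lemma rep_gen_rels:
  assumes "(r, s) \<in> braid_rels n"
  shows "word_eval (GL_tensor n) (rep_gen n) r = word_eval (GL_tensor n) (rep_gen n) s"
proof -
  interpret group "GL_tensor n" by (rule group_GL_tensor)
  have "rep_gen n i \<otimes>\<^bsub>GL_tensor n\<^esub> rep_gen n j = rep_gen n j \<otimes>\<^bsub>GL_tensor n\<^esub> rep_gen n i"
    if "i \<in> {1..n - 1}" "j \<in> {1..n - 1}" "i + 2 \<le> j \<or> j + 2 \<le> i" for i j
    using that rep_gen_commute[of i j n] rep_gen_commute[of j i n] by (auto simp: GL_tensor_mult)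
  \<comment> \<open>The products are bracketed to the right because \<open>word_eval\<close> nests
    that way.\<close>
  moreover have "rep_gen n i \<otimes>\<^bsub>GL_tensor n\<^esub> (rep_gen n (i + 1) \<otimes>\<^bsub>GL_tensor n\<^esub> rep_gen n i) =
      rep_gen n (i + 1) \<otimes>\<^bsub>GL_tensor n\<^esub> (rep_gen n i \<otimes>\<^bsub>GL_tensor n\<^esub> rep_gen n (i + 1))"
    if "1 \<le> i" "i + 2 \<le> n" for i
    using that rep_gen_braid[OF that, folded GL_tensor_mult[of n]] rep_gen_in_GL[of i n]
      rep_gen_in_GL[of "i + 1" n] by (simp add: m_assoc)
  ultimately show ?thesis
    using assms by (auto simp: braid_rels_def rep_gen_in_GL)
qed

lemma braid_rep_class:
  assumes "w \<in> words {1..n - 1}"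
  shows "braid_rep n (pres_rel {1..n - 1} (braid_rels n) `` {w}) =
    word_eval (GL_tensor n) (rep_gen n) w"
  unfolding braid_rep_def
  by (rule group.pres_lift_class[OF group_GL_tensor rep_gen_image_in_GL rep_gen_rels assms])

lemma group_hom_braid_perm: "group_hom (braid_group n) (sym_group n) (braid_perm n)"
  by (simp add: group_hom_def group_hom_axioms_def group_braid_group sym_group_is_group braid_perm_hom)

lemma group_hom_braid_rep: "group_hom (braid_group n) (GL_tensor n) (braid_rep n)"
  by (simp add: group_hom_def group_hom_axioms_def group_braid_group group_GL_tensor braid_rep_hom)

text \<open>The image of a homomorphism is closed under composition, and the one-letter words supply
  the adjacent transpositions.\<close>

lemma braid_perm_surj: "braid_perm n ` carrier (braid_group n) = carrier (sym_group n)"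
proof
  interpret group_hom "braid_group n" "sym_group n" "braid_perm n"
    by (rule group_hom_braid_perm)
  show "braid_perm n ` carrier (braid_group n) \<subseteq> carrier (sym_group n)" by auto
  show "carrier (sym_group n) \<subseteq> braid_perm n ` carrier (braid_group n)"
  proof (rule sym_group_generated_by_adjacent)
    show "id \<in> braid_perm n ` carrier (braid_group n)"
      by (rule image_eqI[OF _ G.one_closed]) (simp add: sym_group_one)
  next
    fix p q
    assume "p \<in> braid_perm n ` carrier (braid_group n)" "q \<in> braid_perm n ` carrier (braid_group n)"
    then obtain x y where "x \<in> carrier (braid_group n)" "p = braid_perm n x"
      "y \<in> carrier (braid_group n)" "q = braid_perm n y" by blast
    then have "p \<circ> q = braid_perm n (x \<otimes>\<^bsub>braid_group n\<^esub> y)"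
      "x \<otimes>\<^bsub>braid_group n\<^esub> y \<in> carrier (braid_group n)" by (auto simp: sym_group_mult)
    then show "p \<circ> q \<in> braid_perm n ` carrier (braid_group n)" by (rule image_eqI)
  next
    fix i assume "1 \<le> i" "i < n"
    then have w: "[(i, True)] \<in> words {1..n - 1}" by simp
    show "transpose i (Suc i) \<in> braid_perm n ` carrier (braid_group n)"
      using braid_perm_class[OF w] presented_group_carrierI[OF w]
      by (intro image_eqI) (auto simp: braid_group_def sym_group_mult sym_group_one)
  qed
qed

section \<open>Jordan-Wigner matrices\<close>

definition pauli_X :: "complex mat" where
  "pauli_X = mat 2 2 (\<lambda>(i, j). if i = j then 0 else 1)"

definition pauli_Z :: "complex mat" where
  "pauli_Z = mat 2 2 (\<lambda>(i, j). if i \<noteq> j then 0 else if i = 0 then 1 else -1)"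

text \<open>These are the \<open>X\<close>-type half of the Clifford generators in the Jordan-Wigner
  transformation. Positions start at 1, hence the a - 1 factors \<open>pauli_Z\<close>.\<close>

definition jordan_wigner :: "nat \<Rightarrow> nat \<Rightarrow> complex mat" where
  "jordan_wigner n a =
    tensor_mat (tensor_mat (tensor_pow pauli_Z (a - 1)) pauli_X) (1\<^sub>m (2 ^ (n - a)))"

lemma dim_pauli [simp]:
  "dim_row pauli_X = 2" "dim_col pauli_X = 2" "dim_row pauli_Z = 2" "dim_col pauli_Z = 2"
  by (simp_all add: pauli_X_def pauli_Z_def)

lemma dim_tensor_pow [simp]:
  "dim_row (tensor_pow M k) = dim_row M ^ k" "dim_col (tensor_pow M k) = dim_col M ^ k"
  by (induction k) (simp_all add: mult.commute)

lemma tensor_mat_one_left [simp]: "tensor_mat (1\<^sub>m (Suc 0)) M = (M :: complex mat)"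
  by (rule eq_matI) (auto simp: tensor_mat_def)

lemma tensor_mat_one_right [simp]: "tensor_mat M (1\<^sub>m (Suc 0)) = (M :: complex mat)"
  by (rule eq_matI) (auto simp: tensor_mat_def)

lemma tensor_pow_add:
  "tensor_pow M (a + b) = tensor_mat (tensor_pow M a) (tensor_pow (M :: complex mat) b)"
  by (induction b) (simp_all add: tensor_mat_assoc)

lemma power_split3: "(n :: nat) = a + b + c \<Longrightarrow> (x :: nat) ^ n = x ^ a * x ^ b * x ^ c"
  by (simp add: power_add)

lemma jordan_wigner_carrier:
  assumes "a \<in> {1..n}"
  shows "jordan_wigner n a \<in> carrier_mat (2 ^ n) (2 ^ n)"
proof -
  have "n = (a - 1) + 1 + (n - a)" using assms by simp
  from power_split3[OF this, of 2] show ?thesis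
    by (auto simp: jordan_wigner_def intro!: carrier_matI)
qed

section \<open>First columns of the Jordan-Wigner matrices\<close>

lemma tensor_pow_pauli_Z_00: "tensor_pow pauli_Z k $$ (0, 0) = 1"
  by (induction k) (simp_all add: index_tensor_mat pauli_Z_def)

text \<open>Under the left-into-right convention the first tensor factor is the lowest binary digit of an
  index, so \<open>\<gamma>\<^sub>a\<close> maps the basis vector \<open>e\<^sub>0\<close> to the one with index \<open>2 ^ (a - 1)\<close>.\<close>

lemma jordan_wigner_first_col_entry:
  assumes "a \<in> {1..n}"
  shows "jordan_wigner n a $$ (2 ^ (a - 1), 0) = 1"
proof -
  obtain b where b: "a = Suc b" using assms by (cases a) auto
  have "(2::nat) ^ b < 2 ^ (b + 1 + (n - a))" by (rule power_strict_increasing) auto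
  then have "(2::nat) ^ b < 2 ^ b * 2 * 2 ^ (n - a)" by (simp only: power_add power_one_right)
  then show ?thesis
    by (simp add: b jordan_wigner_def index_tensor_mat tensor_pow_pauli_Z_00
        pauli_X_def)
qed

text \<open>The dyadic intervals for different \<open>a\<close> are disjoint, so the first column
  determines \<open>a\<close>. The digits below position a - 1 are left unexamined: the interval
  suffices.\<close>

lemma jordan_wigner_first_col:
  assumes "a \<in> {1..n}" "i < 2 ^ n" and nz: "jordan_wigner n a $$ (i, 0) \<noteq> 0"
  shows "2 ^ (a - 1) \<le> i \<and> i < 2 ^ a"
proof -
  obtain b where b: "a = Suc b" using assms(1) by (cases a) auto
  have "n = (a - 1) + 1 + (n - a)" using assms(1) by simp
  from power_split3[OF this, of 2] have "i < 2 ^ b * 2 * 2 ^ (n - a)"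
    using assms(2) by (simp add: b)
  note bounds = this div_mod_bounds[OF this]
  \<comment> \<open>The trailing identity is diagonal, so all higher binary digits of the row index
    vanish.\<close>
  have i: "i < 2 ^ a"
  proof (rule ccontr)
    assume "\<not> i < 2 ^ a"
    then have "i div 2 ^ a \<noteq> 0" by (simp add: div_eq_0_iff)
    then have "i div (2 ^ b * 2) \<noteq> 0" by (simp add: b mult.commute)
    then have "jordan_wigner n a $$ (i, 0) = 0"
      using bounds by (simp add: jordan_wigner_def b index_tensor_mat)
    with nz show False by simp
  qed
  \<comment> \<open>\<open>pauli_X\<close> has zero diagonal, so digit \<open>b\<close> of the row
    index must be 1.\<close>
  have "i \<ge> 2 ^ b"
  proof (rule ccontr)
    assume "\<not> i \<ge> 2 ^ b"
    then have "i mod (2 ^ b * 2) div 2 ^ b = 0" by simp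
    then have "jordan_wigner n a $$ (i, 0) = 0"
      using bounds
      by (simp add: jordan_wigner_def b index_tensor_mat) (simp add: pauli_X_def)
    with nz show False by simp
  qed
  with i show ?thesis by (simp add: b)
qed

section \<open>Conjugation by the braid generators\<close>

lemma tensor_mat_pauli:
  "tensor_mat pauli_X (1\<^sub>m 2) =
    mat_of_rows_list 4 [[0, 1, 0, 0], [1, 0, 0, 0], [0, 0, 0, 1], [0, 0, 1, 0]]"
  "tensor_mat pauli_Z pauli_X =
    mat_of_rows_list 4 [[0, 0, 1, 0], [0, 0, 0, -1], [1, 0, 0, 0], [0, -1, 0, 0]]"
  "tensor_mat pauli_Z pauli_Z =
    mat_of_rows_list 4 [[1, 0, 0, 0], [0, -1, 0, 0], [0, 0, -1, 0], [0, 0, 0, 1]]"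
proof -
  have less4: "i < 4 \<longleftrightarrow> i = 0 \<or> i = 1 \<or> i = 2 \<or> i = 3"
    "i < Suc (Suc (Suc (Suc 0))) \<longleftrightarrow> i = 0 \<or> i = 1 \<or> i = 2 \<or> i = 3" for i :: nat
    by auto
  show "tensor_mat pauli_X (1\<^sub>m 2) =
      mat_of_rows_list 4 [[0, 1, 0, 0], [1, 0, 0, 0], [0, 0, 0, 1], [0, 0, 1, 0]]"
    "tensor_mat pauli_Z pauli_X =
      mat_of_rows_list 4 [[0, 0, 1, 0], [0, 0, 0, -1], [1, 0, 0, 0], [0, -1, 0, 0]]"
    "tensor_mat pauli_Z pauli_Z =
      mat_of_rows_list 4 [[1, 0, 0, 0], [0, -1, 0, 0], [0, 0, -1, 0], [0, 0, 0, 1]]"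
    by (rule eq_matI; auto simp: mat_of_rows_list_def tensor_mat_def pauli_X_def pauli_Z_def less4)+
qed

text \<open>Write \<open>R_mat\<close> as (1 + J) / sqrt 2 with J^2 = -1, so that its square is J.
  As J anticommutes with X (x) I and Z (x) X, conjugation by \<open>R_mat\<close> acts on them as
  left multiplication by J: X (x) I goes to Z (x) X, which goes to -(X (x) I). On Z (x) Z two signs
  cancel and J commutes. The proof compares entries.\<close>

lemma R_mat_pauli:
  "R_mat * tensor_mat pauli_X (1\<^sub>m 2) = tensor_mat pauli_Z pauli_X * R_mat"
  "R_mat * tensor_mat pauli_Z pauli_X = (- 1) \<cdot>\<^sub>m (tensor_mat pauli_X (1\<^sub>m 2) * R_mat)"
  "R_mat * tensor_mat pauli_Z pauli_Z = tensor_mat pauli_Z pauli_Z * R_mat"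
  unfolding tensor_mat_pauli
  by (rule eq_matI; simp add: R_mat_def mat_of_rows_list_def;
      auto simp: scalar_prod_def less_Suc_eq numeral_eq_Suc)+

text \<open>The generator is the identity on both outer blocks, so the mixed-product rule reduces
  the relation to slots \<open>i\<close> and i + 1.\<close>

lemma rep_gen_tensor_comm:
  assumes "R_mat * M = s \<cdot>\<^sub>m (N * R_mat)"
    and "dim_row M = 4" "dim_col N = 4"
    and "A \<in> carrier_mat (2 ^ (i - 1)) (2 ^ (i - 1))"
    and "B \<in> carrier_mat (2 ^ (n - i - 1)) (2 ^ (n - i - 1))"
  shows "rep_gen n i * tensor_mat (tensor_mat A M) B =
    s \<cdot>\<^sub>m (tensor_mat (tensor_mat A N) B * rep_gen n i)"
  using assms
  by (simp add: rep_gen_embed embed_mat_def tensor_mat_mult tensor_mat_smult)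

text \<open>On slots \<open>i\<close> and i + 1 the Jordan-Wigner matrix is X (x) I, Z (x) X, I (x)
  I or Z (x) Z, according to the position of \<open>a\<close>. The scalar is -1 for a = i + 1 and 1
  otherwise.\<close>

lemma rep_gen_jordan_wigner:
  assumes i: "i \<in> {1..n - 1}" and a: "a \<in> {1..n}"
  shows "\<exists>s. s \<noteq> 0 \<and> rep_gen n i * jordan_wigner n a =
    s \<cdot>\<^sub>m (jordan_wigner n (transpose i (i + 1) a) * rep_gen n i)"
proof -
  let ?Z = "tensor_pow pauli_Z"
  have Z_carrier: "?Z k \<in> carrier_mat (2 ^ k) (2 ^ k)" for k by (rule carrier_matI) simp_all
  have one_R: "(1 :: complex) \<cdot>\<^sub>m M = M" for M by (rule eq_matI) auto
  have "n - i = 1 + (n - i - 1)" using i by auto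
  then have "(1\<^sub>m (2 ^ (n - i)) :: complex mat) = tensor_mat (1\<^sub>m 2) (1\<^sub>m (2 ^ (n - i - 1)))"
    using power_split3[of "n - i" 0 1 "n - i - 1" 2] by (simp add: tensor_mat_one)
  then have jw_i: "jordan_wigner n i =
      tensor_mat (tensor_mat (?Z (i - 1)) (tensor_mat pauli_X (1\<^sub>m 2))) (1\<^sub>m (2 ^ (n - i - 1)))"
    by (simp add: jordan_wigner_def tensor_mat_assoc)
  \<comment> \<open>The string for position i + 1 has \<open>i\<close> factors
    \<open>pauli_Z\<close>; the last one sits on slot \<open>i\<close> and is split off.\<close>
  have "i = Suc (i - 1)" using i by simp
  then have "?Z i = tensor_mat (?Z (i - 1)) pauli_Z" using tensor_pow.simps(2)[of _ "i - 1"] by simp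
  then have jw_Suc: "jordan_wigner n (i + 1) =
      tensor_mat (tensor_mat (?Z (i - 1)) (tensor_mat pauli_Z pauli_X)) (1\<^sub>m (2 ^ (n - i - 1)))"
    by (simp add: jordan_wigner_def tensor_mat_assoc)
  consider "a = i" | "a = i + 1" | "a < i" | "i + 2 \<le> a" by linarith
  then show ?thesis
  proof cases
    case 1
    then have "rep_gen n i * jordan_wigner n a =
        1 \<cdot>\<^sub>m (jordan_wigner n (transpose i (i + 1) a) * rep_gen n i)"
      unfolding 1 transpose_apply_first jw_i jw_Suc
      by (intro rep_gen_tensor_comm) (auto simp: R_mat_pauli one_R Z_carrier)
    then show ?thesis by (intro exI[of _ 1]) simp
  next
    case 2
    then have "rep_gen n i * jordan_wigner n a =
        (- 1) \<cdot>\<^sub>m (jordan_wigner n (transpose i (i + 1) a) * rep_gen n i)"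
      unfolding 2 transpose_apply_second jw_i jw_Suc
      by (intro rep_gen_tensor_comm) (auto simp: R_mat_pauli Z_carrier)
    then show ?thesis by (intro exI[of _ "- 1"]) simp
  next
    case 3
    \<comment> \<open>\<open>c\<close> counts the slots strictly between \<open>a\<close> and
      \<open>i\<close>; slots \<open>i\<close> and i + 1 lie in the identity tail.\<close>
    define c where "c = i - 1 - a"
    define A where "A = tensor_mat (tensor_mat (?Z (a - 1)) pauli_X) (1\<^sub>m (2 ^ c))"
    have "n - a = c + 2 + (n - i - 1)" using 3 i a by (auto simp: c_def)
    from power_split3[OF this, of 2] have "(2::nat) ^ (n - a) = 2 ^ c * (4 * 2 ^ (n - i - 1))" by simp
    then have jw: "jordan_wigner n a = tensor_mat (tensor_mat A (1\<^sub>m 4)) (1\<^sub>m (2 ^ (n - i - 1)))"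
      by (simp add: jordan_wigner_def A_def tensor_mat_assoc flip: tensor_mat_one)
    have "i - 1 = (a - 1) + 1 + c" using 3 i a by (auto simp: c_def)
    from power_split3[OF this, of 2] have "(2::nat) ^ (i - 1) = 2 ^ (a - 1) * 2 * 2 ^ c" by simp
    then have A: "A \<in> carrier_mat (2 ^ (i - 1)) (2 ^ (i - 1))"
      by (auto simp: A_def intro!: carrier_matI)
    have "R_mat * 1\<^sub>m 4 = R_mat" "1\<^sub>m 4 * R_mat = R_mat"
      by (auto intro!: right_mult_one_mat left_mult_one_mat carrier_matI)
    then have "rep_gen n i * jordan_wigner n a = 1 \<cdot>\<^sub>m (jordan_wigner n a * rep_gen n i)"
      unfolding jw using A by (intro rep_gen_tensor_comm) (auto simp: one_R)
    moreover have "transpose i (i + 1) a = a" using 3 by (auto simp: transpose_def)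
    ultimately show ?thesis by (intro exI[of _ 1]) simp
  next
    case 4
    \<comment> \<open>\<open>c\<close> counts the slots strictly between i + 1 and \<open>a\<close>;
      slots \<open>i\<close> and i + 1 lie in the \<open>pauli_Z\<close> string.\<close>
    define c where "c = a - i - 2"
    define B where "B = tensor_mat (tensor_mat (?Z c) pauli_X) (1\<^sub>m (2 ^ (n - a)))"
    have a_split: "a - 1 = (i - 1) + (2 + c)" using 4 i by (auto simp: c_def)
    have "?Z 2 = tensor_mat pauli_Z pauli_Z"
      by (simp add: numeral_2_eq_2)
    then have "?Z (a - 1) = tensor_mat (?Z (i - 1)) (tensor_mat (tensor_mat pauli_Z pauli_Z) (?Z c))"
      by (simp only: a_split tensor_pow_add)
    then have jw: "jordan_wigner n a =
        tensor_mat (tensor_mat (?Z (i - 1)) (tensor_mat pauli_Z pauli_Z)) B"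
      by (simp add: jordan_wigner_def B_def tensor_mat_assoc)
    have "n - i - 1 = c + 1 + (n - a)" using 4 i a by (auto simp: c_def)
    from power_split3[OF this, of 2] have "(2::nat) ^ (n - i - 1) = 2 ^ c * 2 * 2 ^ (n - a)" by simp
    then have B: "B \<in> carrier_mat (2 ^ (n - i - 1)) (2 ^ (n - i - 1))"
      by (auto simp: B_def intro!: carrier_matI)
    have "rep_gen n i * jordan_wigner n a = 1 \<cdot>\<^sub>m (jordan_wigner n a * rep_gen n i)"
      unfolding jw using B by (intro rep_gen_tensor_comm) (auto simp: R_mat_pauli one_R Z_carrier)
    moreover have "transpose i (i + 1) a = a" using 4 by (auto simp: transpose_def)
    ultimately show ?thesis by (intro exI[of _ 1]) simp
  qed
qed

section \<open>Permuting the Jordan-Wigner matrices\<close>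

text \<open>Conjugation up to scalars, written as an intertwining relation to avoid inverse
  matrices. Nonzero scalars allow the relation to be inverted.\<close>

definition induces_perm :: "nat \<Rightarrow> complex mat \<Rightarrow> (nat \<Rightarrow> nat) \<Rightarrow> bool" where
  "induces_perm n M \<sigma> \<longleftrightarrow> (\<forall>a\<in>{1..n}. \<exists>s. s \<noteq> 0 \<and>
    M * jordan_wigner n a = s \<cdot>\<^sub>m (jordan_wigner n (\<sigma> a) * M))"

lemma GL_tensor_carrier: "M \<in> carrier (GL_tensor n) \<Longrightarrow> M \<in> carrier_mat (2 ^ n) (2 ^ n)"
  by (simp add: GL_tensor_def units_of_def Units_def ring_mat_def)

lemma GL_tensor_one: "\<one>\<^bsub>GL_tensor n\<^esub> = 1\<^sub>m (2 ^ n)"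
  by (simp add: GL_tensor_def units_of_def ring_mat_def)

lemma induces_perm_one: "induces_perm n (1\<^sub>m (2 ^ n)) id"
  unfolding induces_perm_def
proof
  fix a assume "a \<in> {1..n}"
  note c = jordan_wigner_carrier[OF this]
  have "1\<^sub>m (2 ^ n) * jordan_wigner n a = 1 \<cdot>\<^sub>m (jordan_wigner n (id a) * 1\<^sub>m (2 ^ n))"
    using c by (simp, intro eq_matI) auto
  then show "\<exists>s. s \<noteq> 0 \<and> 1\<^sub>m (2 ^ n) * jordan_wigner n a =
      s \<cdot>\<^sub>m (jordan_wigner n (id a) * 1\<^sub>m (2 ^ n))"
    by (intro exI[of _ 1]) simp
qed

lemma induces_perm_mult:
  assumes M: "M \<in> carrier_mat (2 ^ n) (2 ^ n)" "induces_perm n M \<sigma>"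
    and N: "N \<in> carrier_mat (2 ^ n) (2 ^ n)" "induces_perm n N \<tau>"
    and \<sigma>: "\<sigma> permutes {1..n}" and \<tau>: "\<tau> permutes {1..n}"
  shows "induces_perm n (M * N) (\<sigma> \<circ> \<tau>)"
  unfolding induces_perm_def
proof
  fix a assume a: "a \<in> {1..n}"
  let ?J = "jordan_wigner n"
  have \<tau>a: "\<tau> a \<in> {1..n}" and \<sigma>\<tau>a: "\<sigma> (\<tau> a) \<in> {1..n}"
    using a by (simp_all only: permutes_in_image[OF \<tau>] permutes_in_image[OF \<sigma>])
  note J = jordan_wigner_carrier[OF a] jordan_wigner_carrier[OF \<tau>a] jordan_wigner_carrier[OF \<sigma>\<tau>a]
  obtain s where s: "s \<noteq> 0" "N * ?J a = s \<cdot>\<^sub>m (?J (\<tau> a) * N)"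
    using N(2) a unfolding induces_perm_def by blast
  obtain t where t: "t \<noteq> 0" "M * ?J (\<tau> a) = t \<cdot>\<^sub>m (?J (\<sigma> (\<tau> a)) * M)"
    using M(2) \<tau>a unfolding induces_perm_def by blast
  have "M * N * ?J a = M * (s \<cdot>\<^sub>m (?J (\<tau> a) * N))"
    using M(1) N(1) J by (simp add: assoc_mult_mat[of _ "2 ^ n" "2 ^ n" _ "2 ^ n" _ "2 ^ n"] s)
  also have "\<dots> = s \<cdot>\<^sub>m (M * ?J (\<tau> a) * N)"
    using M(1) N(1) J by (simp add: assoc_mult_mat[of _ "2 ^ n" "2 ^ n" _ "2 ^ n" _ "2 ^ n"]
        mult_smult_distrib[of _ "2 ^ n" "2 ^ n" _ "2 ^ n"])
  also have "\<dots> = s \<cdot>\<^sub>m (t \<cdot>\<^sub>m (?J (\<sigma> (\<tau> a)) * (M * N)))"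
    using M(1) N(1) J by (simp add: t assoc_mult_mat[of _ "2 ^ n" "2 ^ n" _ "2 ^ n" _ "2 ^ n"]
        mult_smult_assoc_mat[of _ "2 ^ n" "2 ^ n" _ "2 ^ n"])
  also have "\<dots> = (s * t) \<cdot>\<^sub>m (?J (\<sigma> (\<tau> a)) * (M * N))"
    by (rule eq_matI) (simp_all add: mult.assoc)
  finally show "\<exists>r. r \<noteq> 0 \<and> M * N * ?J a = r \<cdot>\<^sub>m (?J ((\<sigma> \<circ> \<tau>) a) * (M * N))"
    using s(1) t(1) by (intro exI[of _ "s * t"]) simp
qed

text \<open>Multiply the relation for \<open>M\<close> at \<tau> a by \<open>N\<close> on both
  sides, cancel, and divide by the scalar.\<close>

lemma induces_perm_inverse:
  assumes M: "M \<in> carrier_mat (2 ^ n) (2 ^ n)" "induces_perm n M \<sigma>"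
    and N: "N \<in> carrier_mat (2 ^ n) (2 ^ n)" "M * N = 1\<^sub>m (2 ^ n)" "N * M = 1\<^sub>m (2 ^ n)"
    and \<sigma>: "\<sigma> permutes {1..n}" and inv: "\<sigma> \<circ> \<tau> = id"
  shows "induces_perm n N \<tau>"
  unfolding induces_perm_def
proof
  fix a assume a: "a \<in> {1..n}"
  let ?J = "jordan_wigner n"
  have \<sigma>\<tau>: "\<sigma> (\<tau> a) = a" using inv by (simp add: fun_eq_iff)
  then have \<tau>a: "\<tau> a \<in> {1..n}"
    using a permutes_in_image[OF \<sigma>, of "\<tau> a"] by simp
  note J = jordan_wigner_carrier[OF a] jordan_wigner_carrier[OF \<tau>a]
  obtain s where s: "s \<noteq> 0" "M * ?J (\<tau> a) = s \<cdot>\<^sub>m (?J a * M)"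
    using bspec[OF M(2)[unfolded induces_perm_def] \<tau>a] unfolding \<sigma>\<tau> by blast
  have NM: "N * (M * A) = A" if "A \<in> carrier_mat (2 ^ n) (2 ^ n)" for A
    using that by (simp add: N(3) flip: assoc_mult_mat[OF N(1) M(1) that])
  have "?J (\<tau> a) * N = N * (M * ?J (\<tau> a)) * N"
    using J by (simp add: NM)
  also have "\<dots> = s \<cdot>\<^sub>m (N * ?J a * (M * N))"
    using J M(1) N(1) by (simp add: s assoc_mult_mat[of _ "2 ^ n" "2 ^ n" _ "2 ^ n" _ "2 ^ n"]
        mult_smult_assoc_mat[of _ "2 ^ n" "2 ^ n" _ "2 ^ n"]
        mult_smult_distrib[of _ "2 ^ n" "2 ^ n" _ "2 ^ n"])
  also have "\<dots> = s \<cdot>\<^sub>m (N * ?J a)"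
    using J N by (simp add: right_mult_one_mat[of _ "2 ^ n" "2 ^ n"])
  finally have "N * ?J a = inverse s \<cdot>\<^sub>m (?J (\<tau> a) * N)"
    using s(1) by (auto intro!: eq_matI)
  then show "\<exists>r. r \<noteq> 0 \<and> N * ?J a = r \<cdot>\<^sub>m (?J (\<tau> a) * N)"
    using s(1) by (intro exI[of _ "inverse s"]) simp
qed

text \<open>Both evaluations follow the same word, so induction on its letters links the matrix to
  the permutation of the braid.\<close>

lemma induces_perm_word:
  assumes "w \<in> words {1..n - 1}"
  shows "induces_perm n (word_eval (GL_tensor n) (rep_gen n) w)
    (word_eval (sym_group n) (\<lambda>i. transpose i (i + 1)) w)"
  using assms
proof (induction w)
  case Nil
  show ?case by (simp only: word_eval.simps GL_tensor_one sym_group_one induces_perm_one)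
next
  case (Cons l w)
  interpret GL: group "GL_tensor n" by (rule group_GL_tensor)
  interpret S: group "sym_group n" by (rule sym_group_is_group)
  obtain i b where l: "l = (i, b)" by (cases l)
  let ?R = "rep_gen n i" and ?t = "transpose i (i + 1)"
  have i: "i \<in> {1..n - 1}" and w: "w \<in> words {1..n - 1}" using Cons.prems by (auto simp: l)
  have R: "?R \<in> carrier (GL_tensor n)" using i by (intro rep_gen_in_GL) auto
  have t: "?t \<in> carrier (sym_group n)" using transpose_in_sym_group i by blast
  have R_perm: "induces_perm n ?R ?t"
    using rep_gen_jordan_wigner[OF i] by (simp add: induces_perm_def)
  have "inv\<^bsub>GL_tensor n\<^esub> ?R \<in> carrier (GL_tensor n)" using R by simp
  note inv_carrier = GL_tensor_carrier[OF this]
  \<comment> \<open>A transposition is its own inverse, so a generator and its formal inverse induce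
    the same permutation.\<close>
  have inv_t: "inv\<^bsub>sym_group n\<^esub> ?t = ?t"
    using t by (intro S.inv_equality) (auto simp: sym_group_mult sym_group_one)
  have R_inv_perm: "induces_perm n (inv\<^bsub>GL_tensor n\<^esub> ?R) ?t"
  proof (rule induces_perm_inverse[OF GL_tensor_carrier[OF R] R_perm inv_carrier])
    show "?R * inv\<^bsub>GL_tensor n\<^esub> ?R = 1\<^sub>m (2 ^ n)" "inv\<^bsub>GL_tensor n\<^esub> ?R * ?R = 1\<^sub>m (2 ^ n)"
      using GL.r_inv[OF R] GL.l_inv[OF R] by (simp_all add: GL_tensor_mult GL_tensor_one)
  qed (use t in \<open>simp_all add: sym_group_carrier\<close>)
  have "word_eval (GL_tensor n) (rep_gen n) w \<in> carrier (GL_tensor n)"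
    by (rule GL.word_eval_closed[OF rep_gen_image_in_GL w])
  moreover have "word_eval (sym_group n) (\<lambda>i. transpose i (i + 1)) w \<in> carrier (sym_group n)"
    by (rule S.word_eval_closed[OF transpose_in_sym_group w])
  moreover have "(if b then ?R else inv\<^bsub>GL_tensor n\<^esub> ?R) \<in> carrier_mat (2 ^ n) (2 ^ n)"
    "induces_perm n (if b then ?R else inv\<^bsub>GL_tensor n\<^esub> ?R) ?t"
    using R_perm R_inv_perm inv_carrier GL_tensor_carrier[OF R] by simp_all
  ultimately have "induces_perm n
      ((if b then ?R else inv\<^bsub>GL_tensor n\<^esub> ?R) * word_eval (GL_tensor n) (rep_gen n) w)
      (?t \<circ> word_eval (sym_group n) (\<lambda>i. transpose i (i + 1)) w)"
    using Cons.IH[OF w] t by (intro induces_perm_mult) (simp_all only: sym_group_carrier GL_tensor_carrier)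
  then show ?case
    by (simp only: l word_eval.simps inv_t if_cancel GL_tensor_mult sym_group_mult)
qed

section \<open>The kernel of the representation\<close>

lemma induces_perm_one_imp_id:
  assumes perm: "induces_perm n (1\<^sub>m (2 ^ n)) \<sigma>" and \<sigma>: "\<sigma> permutes {1..n}"
  shows "\<sigma> = id"
proof
  fix a
  show "\<sigma> a = id a"
  proof (cases "a \<in> {1..n}")
    case True
    then have \<sigma>a: "\<sigma> a \<in> {1..n}" by (simp only: permutes_in_image[OF \<sigma>])
    note J = jordan_wigner_carrier[OF True] jordan_wigner_carrier[OF \<sigma>a]
    obtain s where "1\<^sub>m (2 ^ n) * jordan_wigner n a = s \<cdot>\<^sub>m (jordan_wigner n (\<sigma> a) * 1\<^sub>m (2 ^ n))"
      using perm True unfolding induces_perm_def by blast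
    then have eq: "jordan_wigner n a = s \<cdot>\<^sub>m jordan_wigner n (\<sigma> a)"
      using J by simp
    have i: "(2::nat) ^ (a - 1) < 2 ^ n" using True by (intro power_strict_increasing) auto
    \<comment> \<open>Compare the entry that equals 1 for position \<open>a\<close>: it must be
      nonzero for position \<sigma> a as well.\<close>
    have "1 = s * jordan_wigner n (\<sigma> a) $$ (2 ^ (a - 1), 0)"
      using jordan_wigner_first_col_entry[OF True] i J by (simp add: eq)
    \<comment> \<open>The exponents give \<sigma> a - 1 \<le> a - 1 < \<sigma> a, hence
      equality.\<close>
    then have "(2::nat) ^ (\<sigma> a - 1) \<le> 2 ^ (a - 1) \<and> (2::nat) ^ (a - 1) < 2 ^ \<sigma> a"
      by (intro jordan_wigner_first_col[OF \<sigma>a i]) auto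
    then show ?thesis using True \<sigma>a by auto
  qed (use \<sigma> in \<open>simp add: permutes_not_in\<close>)
qed

text \<open>A representing word evaluates to the identity matrix, so that matrix induces the
  permutation of the braid, which must then be trivial.\<close>

lemma kernel_braid_rep_subset_pure:
  "kernel (braid_group n) (GL_tensor n) (braid_rep n) \<subseteq>
    kernel (braid_group n) (sym_group n) (braid_perm n)"
proof
  fix x assume x: "x \<in> kernel (braid_group n) (GL_tensor n) (braid_rep n)"
  then obtain w where w: "w \<in> words {1..n - 1}" "x = pres_rel {1..n - 1} (braid_rels n) `` {w}"
    by (auto simp: kernel_def braid_group_def elim: presented_group_carrierE)
  have "braid_perm n x permutes {1..n}"
    using x braid_perm_hom[of n] by (auto simp: kernel_def hom_def sym_group_carrier)
  moreover have "induces_perm n (1\<^sub>m (2 ^ n)) (braid_perm n x)"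
    using x induces_perm_word[OF w(1)] braid_rep_class[OF w(1)] braid_perm_class[OF w(1)]
    by (simp add: w(2) kernel_def GL_tensor_one)
  ultimately show "x \<in> kernel (braid_group n) (sym_group n) (braid_perm n)"
    using x induces_perm_one_imp_id by (auto simp: kernel_def sym_group_one)
qed

theorem theorem2p6:
  fixes n :: nat
  assumes "n \<ge> 2"
  shows "carrier (H_grp n) \<lhd> G_grp n \<and>
    (\<exists>\<phi>. short_exact_seq (H_grp n) (\<lambda>x. x) (G_grp n) \<phi> (sym_group n))"
  unfolding H_grp_def G_grp_def pure_braids_def
  by (rule short_exact_seq_image[OF group_hom_braid_rep group_hom_braid_perm braid_perm_surj
        kernel_braid_rep_subset_pure])

end
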